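(* Let $A$ be an infinite set of cardinality $\nu$ and let $F\subseteq\mathcal{O}_A$. If $\Upsilon_\omega(\langle F\rangle)$ is an uncountable clone that contains a near unanimity operation, then $|F|=|\Upsilon_\omega(\langle F\rangle)|$. In particular, if $\Upsilon_\omega(\langle F\rangle)=\mathcal{O}_A$, then $|F|=2^\nu$.
   Context: A clone on a nonempty set $A$ is a set of finitary operations on $A$ that contains all projections and is closed under composition; $\mathcal{O}_A$ is the clone of all finitary operations on $A$ and $\langle F\rangle$ is the clone generated by $F$. For $d\ge3$, a $d$-ary operation $h$ on $A$ is a near unanimity operation if $h(a,\dots,a,b,a,\dots,a)=a$ for all $a,b\in A$ and every position of the single $b$. For an ultrafilter $\mathcal{U}$ on a nonempty set $I$, $A^I/\mathcal{U}$ is the ultrapower; for an operation $f$ on $A$, $f_{\mathcal{U}}$ is the operation on $A^I/\mathcal{U}$ induced by applying $f$ coordinatewise, and $\mathcal{C}_{\mathcal{U}}=\{t_{\mathcal{U}}:t\in\mathcal{C}\}$. For finite $\lambda$, an $n$-ary operation $g$ on a set $X$ is $\lambda$-interpolable by a clone $\mathcal{D}$ on $X$ if for every $S\subseteq X^n$ with $|S|\le\lambda$ there is an $n$-ary $t\in\mathcal{D}$ with $g|_S=t|_S$; $f$ is $\lambda$-ultrainterpolable by $\mathcal{C}$ if $f_{\mathcal{U}}$ is $\lambda$-interpolable by $\mathcal{C}_{\mathcal{U}}$ for every ultrafilter $\mathcal{U}$ on every nonempty set $I$. $\Upsilon_\omega(\mathcal{C})$ is the set of all finitary operations on $A$ that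 are $\lambda$-ultrainterpolable by $\mathcal{C}$ for every $\lambda<\omega$. *)

theory Defs
  imports "HOL-Library.NList" "HOL-Library.FuncSet" "HOL-Library.Countable_Set"
begin

unbundle cardinal_syntax

section \<open>Clones\<close>

text \<open>
  An operation is a pair \<open>(n, f)\<close> of its arity and its table. Tables are extensional
  (\<^const>\<open>undefined\<close> outside \<open>A\<^sup>n\<close>), so that distinct pairs are distinct operations and
  cardinalities of sets of pairs are cardinalities of sets of operations. As is usual in clone
  theory, arities are positive.
\<close>

type_synonym 'a operation = "nat \<times> ('a list \<Rightarrow> 'a)"

abbreviation arity :: "'a operation \<Rightarrow> nat" where "arity \<equiv> fst"
abbreviation table :: "'a operation \<Rightarrow> 'a list \<Rightarrow> 'a" where "table \<equiv> snd"

definition operations :: "'a set \<Rightarrow> 'a operation set" where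
  "operations A = (SIGMA n:{0<..}. nlists n A \<rightarrow>\<^sub>E A)"

definition projection :: "'a set \<Rightarrow> nat \<Rightarrow> nat \<Rightarrow> 'a operation" where
  "projection A n i = (n, \<lambda>xs\<in>nlists n A. xs ! i)"

definition composition ::
  "'a set \<Rightarrow> nat \<Rightarrow> 'a operation \<Rightarrow> 'a operation list \<Rightarrow> 'a operation" where
  "composition A k f gs = (k, \<lambda>xs\<in>nlists k A. table f (map (\<lambda>g. table g xs) gs))"

definition clone :: "'a set \<Rightarrow> 'a operation set \<Rightarrow> bool" where
  "clone A C \<longleftrightarrow>
     C \<subseteq> operations A \<and>
     (\<forall>n. \<forall>i<n. projection A n i \<in> C) \<and>
     (\<forall>k. \<forall>f\<in>C. \<forall>gs. length gs = arity f \<and> (\<forall>g\<in>set gs. g \<in> C \<and> arity g = k)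
        \<longrightarrow> composition A k f gs \<in> C)"

definition generated_clone :: "'a set \<Rightarrow> 'a operation set \<Rightarrow> 'a operation set" where
  "generated_clone A F = \<Inter>{C. clone A C \<and> F \<subseteq> C}"

definition near_unanimity :: "'a set \<Rightarrow> 'a operation \<Rightarrow> bool" where
  "near_unanimity A h \<longleftrightarrow>
     h \<in> operations A \<and> 3 \<le> arity h \<and>
     (\<forall>a\<in>A. \<forall>b\<in>A. \<forall>i<arity h. table h ((replicate (arity h) a)[i := b]) = a)"

section \<open>Ultrapowers\<close>

definition ultrafilter_on :: "'i set \<Rightarrow> 'i set set \<Rightarrow> bool" where
  "ultrafilter_on I U \<longleftrightarrow>
     U \<subseteq> Pow I \<and> I \<in> U \<and> {} \<notin> U \<and>
     (\<forall>X\<in>U. \<forall>Y\<in>U. X \<inter> Y \<in> U) \<and>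
     (\<forall>X\<in>U. \<forall>Y. X \<subseteq> Y \<and> Y \<subseteq> I \<longrightarrow> Y \<in> U) \<and>
     (\<forall>X. X \<subseteq> I \<longrightarrow> X \<in> U \<or> I - X \<in> U)"

definition ultra_rel :: "'i set \<Rightarrow> 'i set set \<Rightarrow> 'a set \<Rightarrow> ('i \<Rightarrow> 'a) rel" where
  "ultra_rel I U A = {(x, y) \<in> (I \<rightarrow>\<^sub>E A) \<times> (I \<rightarrow>\<^sub>E A). {i\<in>I. x i = y i} \<in> U}"

definition ultrapower :: "'i set \<Rightarrow> 'i set set \<Rightarrow> 'a set \<Rightarrow> ('i \<Rightarrow> 'a) set set" where
  "ultrapower I U A = (I \<rightarrow>\<^sub>E A) // ultra_rel I U A"

text \<open>
  The union over all lists of representatives is the class of the coordinatewise value;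
  see \<open>ultra_op_class\<close> below.
\<close>

definition ultra_op ::
  "'i set \<Rightarrow> 'i set set \<Rightarrow> 'a set \<Rightarrow> 'a operation \<Rightarrow> ('i \<Rightarrow> 'a) set operation" where
  "ultra_op I U A f =
     (arity f, \<lambda>cs\<in>nlists (arity f) (ultrapower I U A).
        \<Union>xs\<in>{xs. list_all2 (\<in>) xs cs}.
          ultra_rel I U A `` {\<lambda>i\<in>I. table f (map (\<lambda>x. x i) xs)})"

section \<open>Interpolation and ultrainterpolation\<close>

definition interpolable :: "nat \<Rightarrow> 'a set \<Rightarrow> 'a operation \<Rightarrow> 'a operation set \<Rightarrow> bool" where
  "interpolable l X g D \<longleftrightarrow>
     (\<forall>S. S \<subseteq> nlists (arity g) X \<and> finite S \<and> card S \<le> l \<longrightarrow>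
        (\<exists>t\<in>D. arity t = arity g \<and> (\<forall>s\<in>S. table g s = table t s)))"

definition ultrainterpolable_over ::
  "'i itself \<Rightarrow> nat \<Rightarrow> 'a set \<Rightarrow> 'a operation \<Rightarrow> 'a operation set \<Rightarrow> bool" where
  "ultrainterpolable_over _ l A f C \<longleftrightarrow>
     (\<forall>(I :: 'i set) U. I \<noteq> {} \<and> ultrafilter_on I U \<longrightarrow>
        interpolable l (ultrapower I U A) (ultra_op I U A f) (ultra_op I U A ` C))"

text \<open>
  A formula cannot quantify over the types of index sets. Index sets consisting of lists over the
  base type are enough: by \<open>ultrainterpolable_imp_over\<close> below, they yield interpolability for
  every ultrafilter on every nonempty set of any type.
\<close>

definition ultrainterpolable ::
  "nat \<Rightarrow> 'a set \<Rightarrow> 'a operation \<Rightarrow> 'a operation set \<Rightarrow> bool" where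
  "ultrainterpolable l A f C \<longleftrightarrow> ultrainterpolable_over TYPE('a list) l A f C"

definition Upsilon_omega :: "'a set \<Rightarrow> 'a operation set \<Rightarrow> 'a operation set" where
  "Upsilon_omega A C = {f \<in> operations A. \<forall>l. ultrainterpolable l A f C}"

section \<open>Adequacy of the definitions\<close>

lemma ultrafilter_on_mono:
  "ultrafilter_on I U \<Longrightarrow> X \<in> U \<Longrightarrow> X \<subseteq> Y \<Longrightarrow> Y \<subseteq> I \<Longrightarrow> Y \<in> U"
  unfolding ultrafilter_on_def by blast

lemma ultrafilter_on_Int:
  "ultrafilter_on I U \<Longrightarrow> X \<in> U \<Longrightarrow> Y \<in> U \<Longrightarrow> X \<inter> Y \<in> U"
  unfolding ultrafilter_on_def by blast

lemma ultrafilter_on_top: "ultrafilter_on I U \<Longrightarrow> I \<in> U"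
  unfolding ultrafilter_on_def by blast

lemma equiv_ultra_rel:
  assumes "ultrafilter_on I U"
  shows "equiv (I \<rightarrow>\<^sub>E A) (ultra_rel I U A)"
proof (rule equivI)
  show "ultra_rel I U A \<subseteq> (I \<rightarrow>\<^sub>E A) \<times> (I \<rightarrow>\<^sub>E A)"
    by (auto simp: ultra_rel_def)
  show "refl_on (I \<rightarrow>\<^sub>E A) (ultra_rel I U A)"
    using ultrafilter_on_top[OF assms] by (auto simp: refl_on_def ultra_rel_def)
  show "sym (ultra_rel I U A)"
    by (auto simp: sym_def ultra_rel_def eq_commute)
  show "trans (ultra_rel I U A)"
  proof (rule transI)
    fix x y z
    assume 1: "(x, y) \<in> ultra_rel I U A" and 2: "(y, z) \<in> ultra_rel I U A"
    then have "{i\<in>I. x i = y i} \<inter> {i\<in>I. y i = z i} \<in> U"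
      using ultrafilter_on_Int[OF assms] by (auto simp: ultra_rel_def)
    then have "{i\<in>I. x i = z i} \<in> U"
      by (rule ultrafilter_on_mono[OF assms]) auto
    then show "(x, z) \<in> ultra_rel I U A"
      using 1 2 by (auto simp: ultra_rel_def)
  qed
qed

lemma operation_value:
  assumes "f \<in> operations A" "xs \<in> nlists (arity f) A"
  shows "table f xs \<in> A"
  using assms unfolding operations_def by (cases f) auto

lemma coordinatewise_mem:
  assumes "f \<in> operations A" "xs \<in> nlists (arity f) (I \<rightarrow>\<^sub>E A)"
  shows "(\<lambda>i\<in>I. table f (map (\<lambda>x. x i) xs)) \<in> I \<rightarrow>\<^sub>E A"
proof -
  have "table f (map (\<lambda>x. x i) xs) \<in> A" if "i \<in> I" for i
  proof (rule operation_value[OF assms(1)], rule nlistsI)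
    show "length (map (\<lambda>x. x i) xs) = arity f" using assms(2) by simp
    have "x i \<in> A" if "x \<in> set xs" for x
      by (rule PiE_mem[OF subsetD[OF nlistsE_set[OF assms(2)] that] \<open>i \<in> I\<close>])
    then show "set (map (\<lambda>x. x i) xs) \<subseteq> A" by fastforce
  qed
  then show ?thesis by auto
qed

lemma ultrafilter_on_all:
  assumes "ultrafilter_on I U" "\<forall>p<(n::nat). {i\<in>I. P p i} \<in> U"
  shows "{i\<in>I. \<forall>p<n. P p i} \<in> U"
  using assms(2)
proof (induction n)
  case 0
  then show ?case using ultrafilter_on_top[OF assms(1)] by simp
next
  case (Suc n)
  have "{i\<in>I. \<forall>p<n. P p i} \<inter> {i\<in>I. P n i} \<in> U"
    using Suc by (intro ultrafilter_on_Int[OF assms(1)]) auto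
  moreover have "{i\<in>I. \<forall>p<n. P p i} \<inter> {i\<in>I. P n i} = {i\<in>I. \<forall>p<Suc n. P p i}"
    by (auto simp: less_Suc_eq)
  ultimately show ?case by simp
qed

lemma coordinatewise_cong:
  assumes U: "ultrafilter_on I U" and f: "f \<in> operations A"
    and xs: "length xs = arity f" and rel: "list_all2 (\<lambda>x y. (x, y) \<in> ultra_rel I U A) xs ys"
  shows "((\<lambda>i\<in>I. table f (map (\<lambda>x. x i) xs)), (\<lambda>i\<in>I. table f (map (\<lambda>x. x i) ys)))
           \<in> ultra_rel I U A"
proof -
  have len: "length ys = arity f" using rel xs by (auto dest: list_all2_lengthD)
  have r: "(xs ! p, ys ! p) \<in> ultra_rel I U A" if "p < arity f" for p
    using rel that xs by (auto simp: list_all2_conv_all_nth)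
  have mx: "xs \<in> nlists (arity f) (I \<rightarrow>\<^sub>E A)" and my: "ys \<in> nlists (arity f) (I \<rightarrow>\<^sub>E A)"
    using r xs len unfolding nlists_def ultra_rel_def by (fastforce simp: in_set_conv_nth)+
  have "{i\<in>I. \<forall>p<arity f. (xs ! p) i = (ys ! p) i} \<in> U"
    by (rule ultrafilter_on_all[OF U]) (use r in \<open>auto simp: ultra_rel_def\<close>)
  then have "{i\<in>I. (\<lambda>i\<in>I. table f (map (\<lambda>x. x i) xs)) i = (\<lambda>i\<in>I. table f (map (\<lambda>x. x i) ys)) i} \<in> U"
  proof (rule ultrafilter_on_mono[OF U])
    show "{i\<in>I. \<forall>p<arity f. (xs ! p) i = (ys ! p) i}
        \<subseteq> {i\<in>I. (\<lambda>i\<in>I. table f (map (\<lambda>x. x i) xs)) i = (\<lambda>i\<in>I. table f (map (\<lambda>x. x i) ys)) i}"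
    proof clarsimp
      fix i assume "\<forall>p<arity f. (xs ! p) i = (ys ! p) i"
      then have "map (\<lambda>x. x i) xs = map (\<lambda>x. x i) ys"
        using xs len by (intro nth_equalityI) auto
      then show "table f (map (\<lambda>x. x i) xs) = table f (map (\<lambda>x. x i) ys)" by simp
    qed
  qed auto
  then show ?thesis
    using coordinatewise_mem[OF f mx] coordinatewise_mem[OF f my] unfolding ultra_rel_def by blast
qed

lemma classes_mem:
  assumes "xs \<in> nlists n (I \<rightarrow>\<^sub>E A)"
  shows "map (\<lambda>x. ultra_rel I U A `` {x}) xs \<in> nlists n (ultrapower I U A)"
proof (rule nlistsI)
  show "length (map (\<lambda>x. ultra_rel I U A `` {x}) xs) = n" using assms by simp
  have "ultra_rel I U A `` {x} \<in> ultrapower I U A" if "x \<in> set xs" for x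
    unfolding ultrapower_def
    by (rule quotientI) (rule subsetD[OF nlistsE_set[OF assms] that])
  then show "set (map (\<lambda>x. ultra_rel I U A `` {x}) xs) \<subseteq> ultrapower I U A" by fastforce
qed

lemma ultra_op_class:
  assumes U: "ultrafilter_on I U" and f: "f \<in> operations A"
    and xs: "xs \<in> nlists (arity f) (I \<rightarrow>\<^sub>E A)"
  shows "table (ultra_op I U A f) (map (\<lambda>x. ultra_rel I U A `` {x}) xs) =
           ultra_rel I U A `` {\<lambda>i\<in>I. table f (map (\<lambda>x. x i) xs)}"
proof -
  let ?R = "ultra_rel I U A" and ?v = "\<lambda>xs. \<lambda>i\<in>I. table f (map (\<lambda>x. x i) xs)"
  let ?cs = "map (\<lambda>x. ?R `` {x}) xs"
  note eq = equiv_ultra_rel[OF U, of A]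
  have cs: "?cs \<in> nlists (arity f) (ultrapower I U A)"
    using xs by (rule classes_mem)
  have len: "length xs = arity f" using xs by simp
  have "?R `` {?v ys} = ?R `` {?v xs}" if "list_all2 (\<in>) ys ?cs" for ys
  proof -
    have "list_all2 (\<lambda>x y. (x, y) \<in> ?R) xs ys"
      using that by (auto simp: list_all2_conv_all_nth)
    then have "(?v xs, ?v ys) \<in> ?R"
      by (rule coordinatewise_cong[OF U f len])
    then show ?thesis by (metis eq equiv_class_eq)
  qed
  moreover have "list_all2 (\<in>) xs ?cs"
  proof -
    have "x \<in> ?R `` {x}" if "x \<in> set xs" for x
      by (rule equiv_class_self[OF eq]) (rule subsetD[OF nlistsE_set[OF xs] that])
    then show ?thesis by (auto simp: list_all2_conv_all_nth)
  qed
  ultimately have "(\<Union>ys\<in>{ys. list_all2 (\<in>) ys ?cs}. ?R `` {?v ys}) = ?R `` {?v xs}"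
    by blast
  then show ?thesis
    unfolding ultra_op_def snd_conv restrict_apply'[OF cs] .
qed

lemma ultra_op_eq_iff:
  assumes U: "ultrafilter_on I U" and f: "f \<in> operations A" and t: "t \<in> operations A"
    and "arity t = arity f" and xs: "xs \<in> nlists (arity f) (I \<rightarrow>\<^sub>E A)"
  shows "table (ultra_op I U A f) (map (\<lambda>x. ultra_rel I U A `` {x}) xs) =
           table (ultra_op I U A t) (map (\<lambda>x. ultra_rel I U A `` {x}) xs) \<longleftrightarrow>
         {i\<in>I. table f (map (\<lambda>x. x i) xs) = table t (map (\<lambda>x. x i) xs)} \<in> U"
proof -
  have xs': "xs \<in> nlists (arity t) (I \<rightarrow>\<^sub>E A)" using xs assms(4) by simp
  note m = coordinatewise_mem[OF f xs] coordinatewise_mem[OF t xs']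
  have "{i\<in>I. (\<lambda>i\<in>I. table f (map (\<lambda>x. x i) xs)) i = (\<lambda>i\<in>I. table t (map (\<lambda>x. x i) xs)) i}
      = {i\<in>I. table f (map (\<lambda>x. x i) xs) = table t (map (\<lambda>x. x i) xs)}" by auto
  then show ?thesis
    unfolding ultra_op_class[OF U f xs] ultra_op_class[OF U t xs']
      eq_equiv_class_iff[OF equiv_ultra_rel[OF U] m]
    using m by (simp add: ultra_rel_def)
qed

lemma ultrafilter_on_image:
  assumes U: "ultrafilter_on I U"
  shows "ultrafilter_on (g ` I) {Y. Y \<subseteq> g ` I \<and> {i\<in>I. g i \<in> Y} \<in> U}"
proof -
  have cap: "{i\<in>I. g i \<in> X \<and> g i \<in> Y} = {i\<in>I. g i \<in> X} \<inter> {i\<in>I. g i \<in> Y}" for X Y by auto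
  have mono: "{i\<in>I. g i \<in> Y} \<in> U" if "{i\<in>I. g i \<in> X} \<in> U" "X \<subseteq> Y" for X Y
    by (rule ultrafilter_on_mono[OF U that(1)]) (use that(2) in auto)
  have dich: "{i\<in>I. g i \<in> X} \<in> U \<or> I - {i\<in>I. g i \<in> X} \<in> U" for X
    using U unfolding ultrafilter_on_def by simp
  have img: "{i\<in>I. g i \<in> g ` I} = I" by auto
  show ?thesis
    unfolding ultrafilter_on_def
  proof (intro conjI ballI allI impI)
    show "g ` I \<in> {Y. Y \<subseteq> g ` I \<and> {i\<in>I. g i \<in> Y} \<in> U}"
      using ultrafilter_on_top[OF U] img by simp
    show "{} \<notin> {Y. Y \<subseteq> g ` I \<and> {i\<in>I. g i \<in> Y} \<in> U}"
      using U unfolding ultrafilter_on_def by simp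
  next
    fix X Y assume "X \<in> {Y. Y \<subseteq> g ` I \<and> {i\<in>I. g i \<in> Y} \<in> U}"
      and "Y \<in> {Y. Y \<subseteq> g ` I \<and> {i\<in>I. g i \<in> Y} \<in> U}"
    then show "X \<inter> Y \<in> {Y. Y \<subseteq> g ` I \<and> {i\<in>I. g i \<in> Y} \<in> U}"
      using ultrafilter_on_Int[OF U, of "{i\<in>I. g i \<in> X}" "{i\<in>I. g i \<in> Y}"] cap[of X Y] by auto
  next
    fix X Y assume "X \<in> {Y. Y \<subseteq> g ` I \<and> {i\<in>I. g i \<in> Y} \<in> U}" and "X \<subseteq> Y \<and> Y \<subseteq> g ` I"
    then show "Y \<in> {Y. Y \<subseteq> g ` I \<and> {i\<in>I. g i \<in> Y} \<in> U}"
      using mono[of X Y] by simp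
  next
    fix X assume "X \<subseteq> g ` I"
    moreover have "{i\<in>I. g i \<in> g ` I - X} = I - {i\<in>I. g i \<in> X}" by auto
    ultimately show "X \<in> {Y. Y \<subseteq> g ` I \<and> {i\<in>I. g i \<in> Y} \<in> U} \<or>
        g ` I - X \<in> {Y. Y \<subseteq> g ` I \<and> {i\<in>I. g i \<in> Y} \<in> U}"
      using dich[of X] by auto
  qed auto
qed

lemma ultrainterpolable_imp_over:
  assumes ui: "ultrainterpolable l A f C"
    and f: "f \<in> operations A" and C: "C \<subseteq> operations A"
  shows "ultrainterpolable_over TYPE('i) l A f C"
  unfolding ultrainterpolable_over_def interpolable_def
proof (intro allI impI, elim conjE)
  fix I :: "'i set" and U S
  assume "I \<noteq> {}" and U: "ultrafilter_on I U"
    and S: "S \<subseteq> nlists (arity (ultra_op I U A f)) (ultrapower I U A)"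
    and fin: "finite S" and card: "card S \<le> l"
  let ?R = "ultra_rel I U A"
  have S: "S \<subseteq> nlists (arity f) (ultrapower I U A)"
    using S by (simp add: ultra_op_def)
  obtain rep where rep: "\<And>c. c \<in> ultrapower I U A \<Longrightarrow> rep c \<in> I \<rightarrow>\<^sub>E A \<and> c = ?R `` {rep c}"
    unfolding ultrapower_def quotient_def by atomize_elim (rule choice, auto)
  obtain cl where cl: "set cl = (\<Union>s\<in>S. set s)"
    using fin finite_list[of "\<Union>s\<in>S. set s"] by auto
  have clX: "c \<in> ultrapower I U A" if "c \<in> set cl" for c
  proof -
    obtain s where "s \<in> S" "c \<in> set s" using \<open>c \<in> set cl\<close> cl by blast
    moreover have "set s \<subseteq> ultrapower I U A" using S \<open>s \<in> S\<close> by (meson nlistsE_set subsetD)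
    ultimately show ?thesis by blast
  qed
  have repI: "rep c \<in> I \<rightarrow>\<^sub>E A" and repR: "?R `` {rep c} = c" if "c \<in> set cl" for c
    using rep[OF clX[OF that]] by blast+
  have "\<forall>c\<in>set cl. \<exists>p. p < length cl \<and> cl ! p = c"
    by (auto simp: in_set_conv_nth)
  then obtain idx where idx: "\<And>c. c \<in> set cl \<Longrightarrow> idx c < length cl \<and> cl ! idx c = c"
    by (metis bchoice)
  define g where "g i = map (\<lambda>c. rep c i) cl" for i
  define J where "J = g ` I"
  define V where "V = {Y. Y \<subseteq> J \<and> {i\<in>I. g i \<in> Y} \<in> U}"
  define y where "y c = (\<lambda>j\<in>J. j ! idx c)" for c
  have V: "ultrafilter_on J V"
    unfolding V_def J_def by (rule ultrafilter_on_image[OF U])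
  have yg: "y c (g i) = rep c i" if "c \<in> set cl" "i \<in> I" for c i
    using idx[OF that(1)] that(2) by (auto simp: y_def J_def g_def)
  have yJ: "y c \<in> J \<rightarrow>\<^sub>E A" if "c \<in> set cl" for c
  proof -
    have "y c (g i) \<in> A" if "i \<in> I" for i
      using repI[OF \<open>c \<in> set cl\<close>] that by (auto simp: yg[OF \<open>c \<in> set cl\<close> that])
    then show ?thesis by (auto simp: J_def y_def)
  qed
  define T where "T = (\<lambda>s. map (\<lambda>x. ultra_rel J V A `` {x}) (map y s)) ` S"
  have sS: "map y s \<in> nlists (arity f) (J \<rightarrow>\<^sub>E A)" "map rep s \<in> nlists (arity f) (I \<rightarrow>\<^sub>E A)"
    "map (\<lambda>x. ?R `` {x}) (map rep s) = s" "set s \<subseteq> set cl" if "s \<in> S" for s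
  proof -
    show sub: "set s \<subseteq> set cl" using that cl by auto
    have len: "length s = arity f" using that S by (meson nlistsE_length subsetD)
    show "map y s \<in> nlists (arity f) (J \<rightarrow>\<^sub>E A)"
    proof (rule nlistsI)
      show "set (map y s) \<subseteq> J \<rightarrow>\<^sub>E A" unfolding set_map using sub yJ by blast
    qed (simp add: len)
    show "map rep s \<in> nlists (arity f) (I \<rightarrow>\<^sub>E A)"
    proof (rule nlistsI)
      show "set (map rep s) \<subseteq> I \<rightarrow>\<^sub>E A" unfolding set_map using sub repI by blast
    qed (simp add: len)
    have "?R `` {rep c} = c" if "c \<in> set s" for c
      using repR sub that by blast
    then show "map (\<lambda>x. ?R `` {x}) (map rep s) = s"
      by (simp add: map_idI)
  qed
  have "T \<subseteq> nlists (arity f) (ultrapower J V A)"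
    unfolding T_def using classes_mem[OF sS(1)] by blast
  moreover have "finite T" "card T \<le> l"
    using fin card card_image_le[OF fin] by (auto simp: T_def intro: order_trans)
  moreover have "interpolable l (ultrapower J V A) (ultra_op J V A f) (ultra_op J V A ` C)"
    using ui V \<open>I \<noteq> {}\<close> unfolding ultrainterpolable_def ultrainterpolable_over_def J_def by auto
  ultimately have "\<exists>t'\<in>ultra_op J V A ` C. arity t' = arity (ultra_op J V A f) \<and>
      (\<forall>s\<in>T. table (ultra_op J V A f) s = table t' s)"
    unfolding interpolable_def by (simp add: ultra_op_def)
  then obtain t where t: "t \<in> C" "arity t = arity f"
    and eq: "\<And>s. s \<in> T \<Longrightarrow> table (ultra_op J V A f) s = table (ultra_op J V A t) s"
    by (auto simp: ultra_op_def)
  have tA: "t \<in> operations A" using t C by auto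
  have "table (ultra_op I U A f) s = table (ultra_op I U A t) s" if s: "s \<in> S" for s
  proof -
    have "{j\<in>J. table f (map (\<lambda>x. x j) (map y s)) = table t (map (\<lambda>x. x j) (map y s))} \<in> V"
      using eq s unfolding ultra_op_eq_iff[OF V f tA t(2) sS(1)[OF s], symmetric]
      by (auto simp: T_def)
    then have *: "{i\<in>I. g i \<in> {j\<in>J. table f (map (\<lambda>x. x j) (map y s)) =
        table t (map (\<lambda>x. x j) (map y s))}} \<in> U"
      unfolding V_def by blast
    have m: "map (\<lambda>x. x (g i)) (map y s) = map (\<lambda>x. x i) (map rep s)" if "i \<in> I" for i
      using sS(4)[OF s] yg that by auto
    have "{i\<in>I. table f (map (\<lambda>x. x i) (map rep s)) =
        table t (map (\<lambda>x. x i) (map rep s))} \<in> U"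
    proof (rule ultrafilter_on_mono[OF U *], rule subsetI)
      fix i assume i: "i \<in> {i\<in>I. g i \<in> {j\<in>J. table f (map (\<lambda>x. x j) (map y s)) =
        table t (map (\<lambda>x. x j) (map y s))}}"
      then have "i \<in> I" by blast
      with i m[OF this] show "i \<in> {i\<in>I. table f (map (\<lambda>x. x i) (map rep s)) =
        table t (map (\<lambda>x. x i) (map rep s))}"
        unfolding mem_Collect_eq by metis
    qed blast
    then show ?thesis
      using ultra_op_eq_iff[OF U f tA t(2) sS(2)[OF s]] sS(3)[OF s] by simp
  qed
  then show "\<exists>t\<in>ultra_op I U A ` C. arity t = arity (ultra_op I U A f) \<and>
      (\<forall>s\<in>S. table (ultra_op I U A f) s = table t s)"
    using t by (auto simp: ultra_op_def)
qed

end

theory Submission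
  imports Defs "HOL-Library.Equipollence"
begin

text \<open>
  If \<open>h\<close> is a near unanimity operation of arity \<open>d\<close> in \<open>\<Upsilon>\<^sub>\<omega>(\<langle>F\<rangle>)\<close>, then every operation in
  \<open>\<Upsilon>\<^sub>\<omega>(\<langle>F\<rangle>)\<close> lies in \<open>\<langle>F \<union> {h}\<rangle>\<close>: by compactness, \<open>(d - 1)\<close>-ultrainterpolability of \<open>f\<close> is
  witnessed by finitely many operations of \<open>\<langle>F\<rangle>\<close>, and a Baker--Pixley argument combines them with
  \<open>h\<close> into \<open>f\<close> itself. A clone generated by \<open>F \<union> {h}\<close> has at most \<open>|F| + \<omega>\<close> elements, so
  uncountability forces \<open>|F| = |\<Upsilon>\<^sub>\<omega>(\<langle>F\<rangle>)|\<close>.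
\<close>

section \<open>Ultrafilters and compactness\<close>

text \<open>Zorn's lemma gives a maximal family extending \<open>G\<close> with the finite
  intersection property inside \<open>I\<close>, and maximality makes it an ultrafilter.
  Intersecting with \<open>I\<close> handles the empty \<open>K\<close>, whose intersection is the
  whole type.\<close>

lemma ultrafilter_on_extends:
  assumes sub: "G \<subseteq> Pow I"
    and fip: "\<And>K. finite K \<Longrightarrow> K \<subseteq> G \<Longrightarrow> I \<inter> \<Inter>K \<noteq> {}"
  obtains U where "ultrafilter_on I U" "G \<subseteq> U"
proof -
  define \<F> where
    "\<F> = {H. G \<subseteq> H \<and> H \<subseteq> Pow I \<and> (\<forall>K. finite K \<and> K \<subseteq> H \<longrightarrow> I \<inter> \<Inter>K \<noteq> {})}"
  have "\<exists>M\<in>\<F>. \<forall>X\<in>\<F>. M \<subseteq> X \<longrightarrow> X = M"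
  proof (rule subset_Zorn_nonempty)
    show "\<F> \<noteq> {}" using sub fip unfolding \<F>_def by blast
  next
    fix \<C> assume ne: "\<C> \<noteq> {}" and ch: "subset.chain \<F> \<C>"
    have C: "\<C> \<subseteq> \<F>" using ch by (simp add: subset.chain_def)
    have "I \<inter> \<Inter>K \<noteq> {}" if K: "finite K" "K \<subseteq> \<Union>\<C>" for K
    proof -
      obtain B where "B \<in> \<C>" "K \<subseteq> B"
        using finite_subset_Union_chain[OF K ne ch] by blast
      then show ?thesis using C K(1) unfolding \<F>_def by blast
    qed
    moreover have "G \<subseteq> \<Union>\<C>" "\<Union>\<C> \<subseteq> Pow I"
      using C ne unfolding \<F>_def by blast+
    ultimately show "\<Union>\<C> \<in> \<F>" unfolding \<F>_def by blast
  qed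
  then obtain M where M: "M \<in> \<F>" and max: "\<And>X. X \<in> \<F> \<Longrightarrow> M \<subseteq> X \<Longrightarrow> X = M"
    by blast
  have GM: "G \<subseteq> M" and MI: "M \<subseteq> Pow I"
    and Mfip: "\<And>K. finite K \<Longrightarrow> K \<subseteq> M \<Longrightarrow> I \<inter> \<Inter>K \<noteq> {}"
    using M unfolding \<F>_def by blast+
  \<comment> \<open>Maximality enters only here: adjoining a set that meets every finite
    intersection preserves the property, so that set already belongs to \<open>M\<close>.\<close>
  have mem: "X \<in> M" if X: "X \<subseteq> I" and meet: "\<And>K. finite K \<Longrightarrow> K \<subseteq> M \<Longrightarrow> I \<inter> \<Inter>K \<inter> X \<noteq> {}" for X
  proof -
    have "I \<inter> \<Inter>K \<noteq> {}" if "finite K" "K \<subseteq> insert X M" for K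
      using meet[of "K - {X}"] that by blast
    then have "insert X M \<in> \<F>" using GM MI X unfolding \<F>_def by blast
    then show ?thesis using max by blast
  qed
  have up: "X \<in> M" if "finite K" "K \<subseteq> M" "I \<inter> \<Inter>K \<subseteq> X" "X \<subseteq> I" for K X
  proof (rule mem[OF that(4)])
    fix L assume "finite L" "L \<subseteq> M"
    then have "I \<inter> \<Inter>(K \<union> L) \<noteq> {}" using that by (intro Mfip) auto
    then show "I \<inter> \<Inter>L \<inter> X \<noteq> {}" using that(3) by blast
  qed
  have "ultrafilter_on I M"
    unfolding ultrafilter_on_def
  proof (intro conjI ballI allI impI)
    show "M \<subseteq> Pow I" by (rule MI)
    show "I \<in> M" using up[of "{}" I] by simp
    show "{} \<notin> M" using Mfip[of "{{}}"] by auto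
  next
    fix X Y assume "X \<in> M" "Y \<in> M"
    then show "X \<inter> Y \<in> M" using up[of "{X, Y}" "X \<inter> Y"] MI by auto
  next
    fix X Y assume "X \<in> M" "X \<subseteq> Y \<and> Y \<subseteq> I"
    then show "Y \<in> M" using up[of "{X}" Y] by auto
  next
    fix X assume X: "X \<subseteq> I"
    show "X \<in> M \<or> I - X \<in> M"
    proof (rule disjCI)
      assume nX: "I - X \<notin> M"
      show "X \<in> M"
      proof (rule mem[OF X])
        fix K assume "finite K" "K \<subseteq> M"
        then have "\<not> I \<inter> \<Inter>K \<subseteq> I - X" using up[of K "I - X"] nX by blast
        then show "I \<inter> \<Inter>K \<inter> X \<noteq> {}" by blast
      qed
    qed
  qed
  then show thesis using GM by (rule that)
qed

text \<open>
  If no finite set of candidates suffices, the failure sets of the candidates have the finite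
  intersection property, and the generic \<open>l\<close>-tuple over an ultrafilter containing all of them
  cannot be interpolated.
\<close>

lemma ultrainterpolable_imp_finite_interpolation:
  assumes ui: "ultrainterpolable l A f C"
    and f: "f \<in> operations A" and C: "C \<subseteq> operations A" and "A \<noteq> {}"
  obtains T where "finite T" "T \<subseteq> {t \<in> C. arity t = arity f}"
    "\<And>r. r \<in> nlists l (nlists (arity f) A) \<Longrightarrow> \<exists>t\<in>T. \<forall>s\<in>set r. table f s = table t s"
proof (rule ccontr)
  assume neg: "\<not> thesis"
  note thesisI = that
  define n where "n = arity f"
  \<comment> \<open>The index set consists of all \<open>l\<close>-tuples of argument lists, so one
    index is one interpolation problem on \<open>A\<close>.\<close>
  define I where "I = nlists l (nlists n A)"
  define Cn where "Cn = {t \<in> C. arity t = n}"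
  define B where "B t = {r\<in>I. \<exists>s\<in>set r. table f s \<noteq> table t s}" for t
  obtain a where "a \<in> A" using \<open>A \<noteq> {}\<close> by blast
  then have "replicate l (replicate n a) \<in> I"
    unfolding I_def by (intro nlists_replicateI)
  then have Ine: "I \<noteq> {}" by blast
  have fip: "I \<inter> \<Inter>K \<noteq> {}" if K: "finite K" "K \<subseteq> B ` Cn" for K
  proof -
    obtain T where T: "finite T" "T \<subseteq> Cn" "K = B ` T"
      using finite_subset_image[OF K] by blast
    have "\<not> (\<forall>r\<in>I. \<exists>t\<in>T. \<forall>s\<in>set r. table f s = table t s)"
      using neg thesisI T(1,2) unfolding I_def Cn_def n_def by blast
    then show ?thesis unfolding T(3) B_def by blast
  qed
  have "B ` Cn \<subseteq> Pow I" by (auto simp: B_def)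
  then obtain U where U: "ultrafilter_on I U" and BU: "B ` Cn \<subseteq> U"
    using ultrafilter_on_extends[of "B ` Cn" I] fip by blast
  \<comment> \<open>Generic arguments: \<open>xs p\<close> evaluated at the index \<open>r\<close>
    is the \<open>p\<close>-th argument list of \<open>r\<close>. Interpolating at these
    \<open>l\<close> points of the ultrapower means that a single operation solves the problem
    \<open>r\<close> for almost every \<open>r\<close>.\<close>
  define xs where "xs p = map (\<lambda>k. \<lambda>r\<in>I. r ! p ! k) [0..<n]" for p
  have nthI: "r ! p \<in> nlists n A" if "r \<in> I" "p < l" for r p
    using that by (auto simp: I_def intro: nlistsE_nth_in)
  have xs: "xs p \<in> nlists n (I \<rightarrow>\<^sub>E A)" if "p < l" for p
  proof (rule nlistsI)
    have "r ! p ! k \<in> A" if "r \<in> I" "k < n" for r k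
      using nthI[OF that(1) \<open>p < l\<close>] that(2) by (rule nlistsE_nth_in)
    then show "set (xs p) \<subseteq> I \<rightarrow>\<^sub>E A" by (auto simp: xs_def)
  qed (simp add: xs_def)
  have ev: "map (\<lambda>x. x r) (xs p) = r ! p" if "r \<in> I" "p < l" for r p
    using nthI[OF that] that(1) by (intro nth_equalityI) (auto simp: xs_def)
  define cs where "cs p = map (\<lambda>x. ultra_rel I U A `` {x}) (xs p)" for p
  define S where "S = cs ` {..<l}"
  have "S \<subseteq> nlists n (ultrapower I U A)"
    unfolding S_def cs_def using classes_mem[OF xs] by blast
  moreover have "finite S" "card S \<le> l"
    unfolding S_def using card_image_le[of "{..<l}" cs] by simp_all
  \<comment> \<open>The indices have type \<open>'a list list\<close>, while the definition of
    \<open>ultrainterpolable\<close> uses index type \<open>'a list\<close>; the transfer to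
    arbitrary index types bridges the gap.\<close>
  moreover have "interpolable l (ultrapower I U A) (ultra_op I U A f) (ultra_op I U A ` C)"
    using ultrainterpolable_imp_over[OF ui f C, where 'i = "'a list list"] U Ine
    unfolding ultrainterpolable_over_def by simp
  ultimately have "\<exists>t'\<in>ultra_op I U A ` C. arity t' = arity (ultra_op I U A f) \<and>
      (\<forall>s\<in>S. table (ultra_op I U A f) s = table t' s)"
    unfolding interpolable_def by (simp add: ultra_op_def n_def)
  then obtain t where t: "t \<in> C" "arity t = arity f"
    and eq: "\<And>s. s \<in> S \<Longrightarrow> table (ultra_op I U A f) s = table (ultra_op I U A t) s"
    by (auto simp: ultra_op_def)
  have "{r\<in>I. table f (r ! p) = table t (r ! p)} \<in> U" if p: "p < l" for p
  proof -
    have "{r\<in>I. table f (map (\<lambda>x. x r) (xs p)) = table t (map (\<lambda>x. x r) (xs p))} \<in> U"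
      using ultra_op_eq_iff[OF U f subsetD[OF C t(1)] t(2) xs[OF p, unfolded n_def]] eq p
      by (auto simp: S_def cs_def)
    moreover have "{r\<in>I. table f (map (\<lambda>x. x r) (xs p)) = table t (map (\<lambda>x. x r) (xs p))} =
        {r\<in>I. table f (r ! p) = table t (r ! p)}"
      using ev[OF _ p] by auto
    ultimately show ?thesis by simp
  qed
  then have "{r\<in>I. \<forall>p<l. table f (r ! p) = table t (r ! p)} \<in> U"
    by (intro ultrafilter_on_all[OF U]) auto
  moreover have "B t \<in> U" using BU t by (auto simp: Cn_def n_def)
  ultimately have "{r\<in>I. \<forall>p<l. table f (r ! p) = table t (r ! p)} \<inter> B t \<in> U"
    by (rule ultrafilter_on_Int[OF U])
  \<comment> \<open>The operation \<open>t\<close> solves every problem in the first set and fails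
    at every one in \<open>B t\<close>, yet both sets are in \<open>U\<close>.\<close>
  moreover have "{r\<in>I. \<forall>p<l. table f (r ! p) = table t (r ! p)} \<inter> B t = {}"
    by (auto simp: B_def I_def in_set_conv_nth)
  ultimately show False using U by (simp add: ultrafilter_on_def)
qed

section \<open>Generated clones\<close>

lemma projection_mem_operations: "i < n \<Longrightarrow> projection A n i \<in> operations A"
  by (auto simp: projection_def operations_def intro: nlistsE_nth_in)

lemma composition_mem_operations:
  assumes f: "f \<in> operations A" and len: "length gs = arity f"
    and gs: "\<And>g. g \<in> set gs \<Longrightarrow> g \<in> operations A \<and> arity g = k"
  shows "composition A k f gs \<in> operations A"
proof -
  \<comment> \<open>Arities are positive, so \<open>gs\<close> is nonempty and any member of it
    forces \<open>k\<close> to be positive.\<close>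
  have "0 < arity f" using f by (auto simp: operations_def)
  then obtain g where "g \<in> set gs" using len by (cases gs) auto
  then have k: "0 < k" using gs by (fastforce simp: operations_def)
  have "table f (map (\<lambda>g. table g xs) gs) \<in> A" if "xs \<in> nlists k A" for xs
  proof (rule operation_value[OF f nlistsI])
    show "set (map (\<lambda>g. table g xs) gs) \<subseteq> A"
      using gs operation_value that by fastforce
  qed (simp add: len)
  with k show ?thesis by (auto simp: composition_def operations_def)
qed

lemma clone_operations: "clone A (operations A)"
  by (auto simp: clone_def intro: projection_mem_operations intro!: composition_mem_operations)

lemma generated_clone_least: "clone A C \<Longrightarrow> F \<subseteq> C \<Longrightarrow> generated_clone A F \<subseteq> C"
  unfolding generated_clone_def by blast

lemma generated_clone_superset: "F \<subseteq> generated_clone A F"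
  unfolding generated_clone_def by blast

lemma generated_clone_mono: "F \<subseteq> G \<Longrightarrow> generated_clone A F \<subseteq> generated_clone A G"
  unfolding generated_clone_def by blast

text \<open>The assumption on \<open>F\<close> makes \<open>operations A\<close> one of the
  intersected clones, which bounds the intersection; the closure conditions pass to it from the
  individual clones.\<close>

lemma clone_generated_clone:
  assumes "F \<subseteq> operations A"
  shows "clone A (generated_clone A F)"
  unfolding clone_def
proof (intro conjI allI ballI impI)
  show "generated_clone A F \<subseteq> operations A"
    using generated_clone_least[OF clone_operations assms] .
next
  fix n i :: nat assume "i < n"
  then show "projection A n i \<in> generated_clone A F"
    by (auto simp: generated_clone_def clone_def)
next
  fix k f gs
  assume f: "f \<in> generated_clone A F"
    and gs: "length gs = arity f \<and> (\<forall>g\<in>set gs. g \<in> generated_clone A F \<and> arity g = k)"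
  show "composition A k f gs \<in> generated_clone A F"
    unfolding generated_clone_def
  proof (rule InterI)
    fix C assume C: "C \<in> {C. clone A C \<and> F \<subseteq> C}"
    then have "generated_clone A F \<subseteq> C" using generated_clone_least by blast
    with f gs have "f \<in> C" "\<forall>g\<in>set gs. g \<in> C \<and> arity g = k" by blast+
    with C gs show "composition A k f gs \<in> C" by (simp add: clone_def)
  qed
qed

section \<open>Cardinality of generated clones\<close>

lemma card_of_Times_ordLeq_infinite:
  "infinite K \<Longrightarrow> |B| \<le>o |K| \<Longrightarrow> |C| \<le>o |K| \<Longrightarrow> |B \<times> C| \<le>o |K|"
  by (simp add: card_of_Sigma_ordLeq_infinite)

lemma countable_iff_card_of: "countable B \<longleftrightarrow> |B| \<le>o |UNIV :: nat set|"
  by (simp add: countable_def flip: card_of_ordLeq)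

text \<open>Lists form a countable union of finite powers, each of size at most that of
  \<open>K\<close>.\<close>

lemma card_of_lists_ordLeq_infinite:
  assumes K: "infinite K" and B: "|B| \<le>o |K|"
  shows "|lists B| \<le>o |K|"
proof -
  have nl: "|nlists n B| \<le>o |K|" for n
  proof (induction n)
    case 0
    show ?case using K by (auto intro: card_of_singl_ordLeq)
  next
    case (Suc n)
    have "nlists (Suc n) B = (\<lambda>(x, xs). x # xs) ` (B \<times> nlists n B)"
      by (auto simp: nlists_Suc)
    then have "|nlists (Suc n) B| \<le>o |B \<times> nlists n B|"
      using card_of_image by metis
    also have "|B \<times> nlists n B| \<le>o |K|"
      by (rule card_of_Times_ordLeq_infinite[OF K B Suc])
    finally show ?case .
  qed
  have "lists B = (\<Union>n. nlists n B)"
    unfolding nlists_def lists_eq_set by blast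
  moreover have "|UNIV :: nat set| \<le>o |K|"
    using K by (simp add: infinite_iff_card_of_nat)
  then have "|\<Union>n. nlists n B| \<le>o |K|"
    by (rule card_of_UNION_ordLeq_infinite[OF K]) (simp add: nl)
  ultimately show ?thesis by simp
qed

text \<open>The generated clone lies in a union of countably many stages: start with
  \<open>F\<close> and the projections, then repeatedly add all compositions. A composition is coded
  by a number, an operation and a list of operations, so no stage outgrows \<open>K\<close>.\<close>

lemma card_of_generated_clone:
  assumes F: "F \<subseteq> operations A" and K: "infinite K" and FK: "|F| \<le>o |K|"
  shows "|generated_clone A F| \<le>o |K|"
proof -
  define P where "P = {projection A n i |n i. i < n}"
  define V where "V X = {(k, f, gs). f \<in> X \<and> length gs = arity f \<and>
      (\<forall>g\<in>set gs. g \<in> X \<and> arity g = k)}" for X :: "'a operation set"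
  define st where "st X = X \<union> (\<lambda>(k, f, gs). composition A k f gs) ` V X" for X
  define G where "G m = (st ^^ m) (F \<union> P)" for m
  have G0: "G 0 = F \<union> P" and GS: "G (Suc m) = st (G m)" for m by (simp_all add: G_def)
  have nat: "|UNIV :: nat set| \<le>o |K|"
    using K by (simp add: infinite_iff_card_of_nat)
  have card: "|G m| \<le>o |K|" for m
  proof (induction m)
    case 0
    have "P = (\<lambda>(n, i). projection A n i) ` {(n, i). i < n}" by (force simp: P_def)
    then have "P \<subseteq> (\<lambda>(n, i). projection A n i) ` (UNIV \<times> UNIV)" by blast
    then have "|P| \<le>o |UNIV \<times> UNIV :: (nat \<times> nat) set|"
      using card_of_mono1 card_of_image ordLeq_transitive by metis
    then have "|P| \<le>o |K|"
      using card_of_Times_ordLeq_infinite[OF K nat nat] ordLeq_transitive by blast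
    then show ?case unfolding G0 using K FK
      by (intro card_of_Un_ordLeq_infinite_Field) (simp_all add: Field_card_of card_of_card_order_on)
  next
    case (Suc m)
    have "V (G m) \<subseteq> UNIV \<times> G m \<times> lists (G m)" by (auto simp: V_def)
    then have "|V (G m)| \<le>o |(UNIV :: nat set) \<times> G m \<times> lists (G m)|" by (rule card_of_mono1)
    also have "|(UNIV :: nat set) \<times> G m \<times> lists (G m)| \<le>o |K|"
      by (intro card_of_Times_ordLeq_infinite[OF K] nat Suc card_of_lists_ordLeq_infinite[OF K])
    finally have "|(\<lambda>(k, f, gs). composition A k f gs) ` V (G m)| \<le>o |K|"
      using card_of_image ordLeq_transitive by blast
    then show ?case unfolding GS st_def using K Suc
      by (intro card_of_Un_ordLeq_infinite_Field) (simp_all add: Field_card_of card_of_card_order_on)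
  qed
  have mono: "G m \<subseteq> G m'" if "m \<le> m'" for m m'
    by (rule lift_Suc_mono_le[OF _ that]) (auto simp: GS st_def)
  have ops: "G m \<subseteq> operations A" for m
  proof (induction m)
    case 0
    then show ?case using F projection_mem_operations by (auto simp: G0 P_def)
  next
    case (Suc m)
    have "composition A k f gs \<in> operations A" if "(k, f, gs) \<in> V (G m)" for k f gs
      by (rule composition_mem_operations) (use that Suc in \<open>auto simp: V_def\<close>)
    with Suc show ?case unfolding GS st_def by auto
  qed
  have "clone A (\<Union>m. G m)"
    unfolding clone_def
  proof (intro conjI allI ballI impI)
    show "(\<Union>m. G m) \<subseteq> operations A" using ops by blast
  next
    fix n i :: nat assume "i < n"
    then have "projection A n i \<in> G 0" by (auto simp: G0 P_def)
    then show "projection A n i \<in> (\<Union>m. G m)" by blast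
  next
    fix k f gs
    assume f: "f \<in> (\<Union>m. G m)"
      and gs: "length gs = arity f \<and> (\<forall>g\<in>set gs. g \<in> (\<Union>m. G m) \<and> arity g = k)"
    \<comment> \<open>A composition involves finitely many operations, so all of them are present at
      a common stage \<open>m\<close> and the result at the next one.\<close>
    have "\<forall>g\<in>insert f (set gs). \<exists>m. g \<in> G m" using f gs by blast
    then obtain \<mu> where \<mu>: "\<And>g. g \<in> insert f (set gs) \<Longrightarrow> g \<in> G (\<mu> g)"
      by (metis bchoice)
    define m where "m = Max (\<mu> ` insert f (set gs))"
    have "g \<in> G m" if "g \<in> insert f (set gs)" for g
      using \<mu>[OF that] mono[of "\<mu> g" m] that unfolding m_def by (auto intro: Max_ge)
    then have "(k, f, gs) \<in> V (G m)" using gs by (auto simp: V_def)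
    then have "composition A k f gs \<in> G (Suc m)" unfolding GS st_def by force
    then show "composition A k f gs \<in> (\<Union>m. G m)" by blast
  qed
  moreover have "F \<subseteq> (\<Union>m. G m)" using G0 by blast
  ultimately have "generated_clone A F \<subseteq> (\<Union>m. G m)" by (rule generated_clone_least)
  then have "|generated_clone A F| \<le>o |\<Union>m. G m|" by (rule card_of_mono1)
  also have "|\<Union>m. G m| \<le>o |K|"
    by (rule card_of_UNION_ordLeq_infinite[OF K nat]) (simp add: card)
  finally show ?thesis .
qed

section \<open>The Baker--Pixley argument\<close>

text \<open>
  The sets \<open>E x\<close> of candidates agreeing with \<open>f\<close> at \<open>x\<close> form a finite family, even though
  \<open>A\<close> is infinite. As in the Baker--Pixley theorem, a near unanimity operation glues operations
  that are correct on smaller subfamilies into one that is correct on the whole family.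
\<close>

lemma finite_interpolation_imp_mem_clone:
  assumes G: "clone A G" and hG: "h \<in> G" and h: "near_unanimity A h"
    and f: "f \<in> operations A" and T: "finite T" "T \<subseteq> {t \<in> G. arity t = arity f}"
    and interp: "\<And>r. r \<in> nlists (arity h - 1) (nlists (arity f) A) \<Longrightarrow>
      \<exists>t\<in>T. \<forall>s\<in>set r. table f s = table t s"
    and "A \<noteq> {}"
  shows "f \<in> G"
proof -
  define n where "n = arity f"
  define d where "d = arity h"
  define X where "X = nlists n A"
  define E where "E x = {t\<in>T. table f x = table t x}" for x
  have d: "3 \<le> d" using h by (simp add: near_unanimity_def d_def)
  have nu: "table h ((replicate d a)[i := b]) = a" if "a \<in> A" "b \<in> A" "i < d" for a b i
    using h that by (simp add: near_unanimity_def d_def)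
  have Gops: "G \<subseteq> operations A" using G by (simp add: clone_def)
  obtain a where "a \<in> A" using \<open>A \<noteq> {}\<close> by blast
  then have aX: "replicate n a \<in> X" unfolding X_def by (rule nlists_replicateI)
  have fX: "table f x \<in> A" if "x \<in> X" for x
    using operation_value[OF f] that by (simp add: X_def n_def)
  have "finite (E ` X)"
    by (rule finite_subset[of _ "Pow T"]) (use T(1) in \<open>auto simp: E_def\<close>)
  \<comment> \<open>Induction on the subfamily: \<open>s\<close> need only be correct at points
    \<open>x\<close> whose set \<open>E x\<close> belongs to \<open>\<S>\<close>.\<close>
  have glue: "\<exists>s\<in>G. arity s = n \<and> (\<forall>x\<in>X. E x \<in> \<S> \<longrightarrow> table s x = table f x)"
    if "finite \<S>" "\<S> \<subseteq> E ` X" for \<S>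
    using that
  proof (induction \<S> rule: finite_psubset_induct)
    case (psubset \<S>)
    obtain es where es: "set es = \<S>" "distinct es"
      using finite_distinct_list[OF psubset.hyps] by blast
    show ?case
    proof (cases "length es < d")
      case True
      have "\<forall>e\<in>\<S>. \<exists>x\<in>X. E x = e" using psubset.prems by blast
      then obtain rep where rep: "\<And>e. e \<in> \<S> \<Longrightarrow> rep e \<in> X \<and> E (rep e) = e"
        by (metis bchoice)
      \<comment> \<open>With at most \<open>d - 1\<close> members, take one point for each and pad
        with a constant list to the exact length that the interpolation hypothesis demands.\<close>
      define r where "r = map rep es @ replicate (d - 1 - length es) (replicate n a)"
      have "length r = d - 1" using True by (simp add: r_def)
      moreover have "set r \<subseteq> X" using rep es aX by (auto simp: r_def)
      ultimately have "r \<in> nlists (arity h - 1) (nlists (arity f) A)"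
        unfolding d_def X_def n_def by (rule nlistsI)
      from interp[OF this] obtain t where t: "t \<in> T" "\<forall>s\<in>set r. table f s = table t s"
        by blast
      \<comment> \<open>Membership in \<open>E x\<close> records correctness at \<open>x\<close>, so
        correctness at one representative gives correctness at every point with the same
        set.\<close>
      have "t \<in> e" if "e \<in> \<S>" for e
      proof -
        have "rep e \<in> set r" using that es by (auto simp: r_def)
        then have "t \<in> E (rep e)" using t by (simp add: E_def)
        then show ?thesis using rep[OF that] by simp
      qed
      then have "table t x = table f x" if "E x \<in> \<S>" for x
        using that by (fastforce simp: E_def)
      then show ?thesis using t(1) T(2) by (auto simp: n_def)
    next
      case False
      \<comment> \<open>With at least \<open>d\<close> members, each of the first \<open>d\<close>
        is dropped in turn and the induction hypothesis is applied to the rest.\<close>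
      have "\<forall>i\<in>{..<d}. \<exists>s. s \<in> G \<and> arity s = n \<and>
          (\<forall>x\<in>X. E x \<in> \<S> - {es ! i} \<longrightarrow> table s x = table f x)"
      proof
        fix i assume "i \<in> {..<d}"
        then have "es ! i \<in> \<S>" using False es by auto
        then have "\<S> - {es ! i} \<subset> \<S>" by blast
        from psubset.IH[OF this] psubset.prems
        show "\<exists>s. s \<in> G \<and> arity s = n \<and>
            (\<forall>x\<in>X. E x \<in> \<S> - {es ! i} \<longrightarrow> table s x = table f x)" by blast
      qed
      from bchoice[OF this] obtain s where sG: "\<And>i. i < d \<Longrightarrow> s i \<in> G \<and> arity (s i) = n"
        and sf: "\<And>i x. i < d \<Longrightarrow> x \<in> X \<Longrightarrow> E x \<in> \<S> \<Longrightarrow> E x \<noteq> es ! i \<Longrightarrow>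
          table (s i) x = table f x"
        by auto
      let ?c = "composition A n h (map s [0..<d])"
      have "length (map s [0..<d]) = arity h \<and>
          (\<forall>g\<in>set (map s [0..<d]). g \<in> G \<and> arity g = n)"
        using sG by (auto simp: d_def)
      then have "?c \<in> G" using G hG unfolding clone_def by blast
      moreover have "table ?c x = table f x" if x: "x \<in> X" "E x \<in> \<S>" for x
      proof -
        \<comment> \<open>Since \<open>es\<close> is distinct, \<open>E x\<close> is at most one of
          the first \<open>d\<close> members, so at most one of the \<open>d\<close> values can be
          wrong. If it is none of them, all values are right and 0 is an arbitrary choice of
          exceptional position.\<close>
        have "\<exists>i0<d. \<forall>i<d. i \<noteq> i0 \<longrightarrow> E x \<noteq> es ! i"
        proof (cases "\<exists>i0<d. E x = es ! i0")
          case True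
          then obtain i0 where "i0 < d" "E x = es ! i0" by blast
          then show ?thesis
            using False es(2) by (intro exI[of _ i0]) (auto simp: nth_eq_iff_index_eq)
        next
          case False
          then show ?thesis using d by (intro exI[of _ 0]) auto
        qed
        then obtain i0 where i0: "i0 < d" "\<And>i. i < d \<Longrightarrow> i \<noteq> i0 \<Longrightarrow> E x \<noteq> es ! i" by blast
        have "map (\<lambda>g. table g x) (map s [0..<d]) =
            (replicate d (table f x))[i0 := table (s i0) x]"
          using sf[OF _ x] i0 by (intro nth_equalityI) (auto simp: nth_list_update)
        moreover have "table (s i0) x \<in> A"
          using sG[OF i0(1)] Gops x(1) by (auto simp: X_def intro!: operation_value)
        ultimately show ?thesis
          using nu[OF fX[OF x(1)] _ i0(1)] x(1) by (simp add: composition_def X_def)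
      qed
      moreover have "arity ?c = n" by (simp add: composition_def)
      ultimately show ?thesis by blast
    qed
  qed
  from glue[OF \<open>finite (E ` X)\<close> subset_refl] obtain s
    where s: "s \<in> G" "arity s = arity f" and eq: "\<And>x. x \<in> X \<Longrightarrow> table s x = table f x"
    by (auto simp: n_def)
  \<comment> \<open>Tables are extensional, so agreement on \<open>X\<close> is equality.\<close>
  have ext: "table g \<in> extensional (nlists (arity g) A)" if "g \<in> operations A" for g
    using that by (auto simp: operations_def PiE_def)
  have "table s = table f"
  proof (rule extensionalityI)
    show "table s \<in> extensional (nlists (arity f) A)" using ext[of s] s Gops by auto
    show "table f \<in> extensional (nlists (arity f) A)" by (rule ext[OF f])
  qed (use eq in \<open>simp add: X_def n_def\<close>)
  with s(2) have "s = f" by (simp add: prod_eq_iff)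
  with s(1) show ?thesis by simp
qed

text \<open>The Baker--Pixley step needs interpolation at \<open>arity h - 1\<close> points, so
  compactness is applied at that level. As \<open>h\<close> may lie outside the clone generated by
  \<open>F\<close>, it is adjoined to the generators.\<close>

lemma Upsilon_omega_subset:
  assumes F: "F \<subseteq> operations A" and "A \<noteq> {}"
    and h: "h \<in> operations A" "near_unanimity A h"
  shows "Upsilon_omega A (generated_clone A F) \<subseteq> generated_clone A (insert h F)"
proof
  fix f assume "f \<in> Upsilon_omega A (generated_clone A F)"
  then have f: "f \<in> operations A"
    and ui: "ultrainterpolable (arity h - 1) A f (generated_clone A F)"
    by (auto simp: Upsilon_omega_def)
  have C: "generated_clone A F \<subseteq> operations A"
    using clone_generated_clone[OF F] by (simp add: clone_def)
  obtain T where T: "finite T" "T \<subseteq> {t \<in> generated_clone A F. arity t = arity f}"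
    and interp: "\<And>r. r \<in> nlists (arity h - 1) (nlists (arity f) A) \<Longrightarrow>
      \<exists>t\<in>T. \<forall>s\<in>set r. table f s = table t s"
    using ultrainterpolable_imp_finite_interpolation[OF ui f C \<open>A \<noteq> {}\<close>] by blast
  have "T \<subseteq> {t \<in> generated_clone A (insert h F). arity t = arity f}"
    using T(2) generated_clone_mono[of F "insert h F" A] by blast
  moreover have "h \<in> generated_clone A (insert h F)"
    using generated_clone_superset[of "insert h F" A] by blast
  moreover have "clone A (generated_clone A (insert h F))"
    using F h(1) by (intro clone_generated_clone) blast
  ultimately show "f \<in> generated_clone A (insert h F)"
    using finite_interpolation_imp_mem_clone[OF _ _ h(2) f T(1) _ interp \<open>A \<noteq> {}\<close>] by blast
qed

text \<open>An operation of \<open>C\<close> interpolates itself in every ultrapower.\<close>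

lemma subset_Upsilon_omega:
  assumes "C \<subseteq> operations A"
  shows "C \<subseteq> Upsilon_omega A C"
proof
  fix f assume "f \<in> C"
  then show "f \<in> Upsilon_omega A C"
    using assms
    by (auto simp: Upsilon_omega_def ultrainterpolable_def ultrainterpolable_over_def
        interpolable_def)
qed

lemma card_of_Upsilon_omega:
  assumes F: "F \<subseteq> operations A" and "A \<noteq> {}"
    and unc: "uncountable (Upsilon_omega A (generated_clone A F))"
    and h: "h \<in> Upsilon_omega A (generated_clone A F)" "near_unanimity A h"
  shows "|F| =o |Upsilon_omega A (generated_clone A F)|"
proof -
  let ?Y = "Upsilon_omega A (generated_clone A F)"
  have hA: "h \<in> operations A" using h(1) by (simp add: Upsilon_omega_def)
  have FhA: "insert h F \<subseteq> operations A" using F hA by blast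
  have Y: "|?Y| \<le>o |generated_clone A (insert h F)|"
    by (rule card_of_mono1[OF Upsilon_omega_subset[OF F \<open>A \<noteq> {}\<close> hA h(2)]])
  \<comment> \<open>A finite \<open>F\<close> together with \<open>h\<close> would generate a
    countable clone. Once \<open>F\<close> is infinite, adding \<open>h\<close> leaves its size
    unchanged.\<close>
  have "infinite F"
  proof
    assume "finite F"
    then have "|insert h F| \<le>o |UNIV :: nat set|"
      by (simp add: countable_finite flip: countable_iff_card_of)
    then have "|generated_clone A (insert h F)| \<le>o |UNIV :: nat set|"
      by (intro card_of_generated_clone[OF FhA]) auto
    with Y have "|?Y| \<le>o |UNIV :: nat set|" by (rule ordLeq_transitive)
    then have "countable ?Y" by (simp add: countable_iff_card_of)
    with unc show False by simp
  qed
  then have "|insert h F| \<le>o |F|"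
    using infinite_insert_lepoll[of F h] unfolding lepoll_def card_of_ordLeq by blast
  then have "|generated_clone A (insert h F)| \<le>o |F|"
    by (rule card_of_generated_clone[OF FhA \<open>infinite F\<close>])
  with Y have "|?Y| \<le>o |F|" by (rule ordLeq_transitive)
  moreover have "F \<subseteq> ?Y"
    using generated_clone_superset[of F A] subset_Upsilon_omega[of "generated_clone A F" A]
      clone_generated_clone[OF F] by (auto simp: clone_def)
  then have "|F| \<le>o |?Y|" by (rule card_of_mono1)
  ultimately show ?thesis by (simp add: ordIso_iff_ordLeq)
qed

section \<open>The clone of all operations\<close>

text \<open>The ternary operation returning x if x = z and y otherwise: a deviating middle entry
  leaves x = z, and a deviating outer entry makes the middle one the answer.\<close>

lemma majority_exists: "\<exists>h\<in>operations A. near_unanimity A h"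
proof
  let ?h = "(3, \<lambda>xs\<in>nlists 3 A. if xs ! 0 = xs ! 2 then xs ! 0 else xs ! 1)"
  show h: "?h \<in> operations A"
    using nlistsE_nth_in[of _ 3 A] by (auto simp: operations_def)
  show "near_unanimity A ?h"
    unfolding near_unanimity_def
  proof (intro conjI ballI allI impI)
    fix a b and i :: nat assume "a \<in> A" "b \<in> A" and i: "i < arity ?h"
    then have "(replicate 3 a)[i := b] \<in> nlists 3 A"
      by (intro nlists_update_in_list nlists_replicateI)
    moreover have "i = 0 \<or> i = 1 \<or> i = 2" using i by auto
    ultimately show "table ?h ((replicate (arity ?h) a)[i := b]) = a"
      by (auto simp: nth_list_update)
  qed (use h in auto)
qed

text \<open>From above, an operation is coded by its graph, a subset of
  \<open>lists A \<times> A\<close>; from below, subsets of \<open>A\<close> give distinct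
  two-valued unary operations.\<close>

lemma card_of_operations:
  assumes A: "infinite A"
  shows "|operations A| =o |Pow A|"
proof -
  have ne: "A \<noteq> {}" using A by auto
  define gr where "gr f = (\<lambda>xs. (xs, table f xs)) ` nlists (arity f) A" for f :: "'a operation"
  have "inj_on gr (operations A)"
  proof (rule inj_onI)
    fix f g assume f: "f \<in> operations A" and g: "g \<in> operations A" and eq: "gr f = gr g"
    \<comment> \<open>The first components of the graph are the argument lists; as \<open>A\<close>
      is nonempty, their length reveals the arity.\<close>
    have "fst ` gr f = fst ` gr g" using eq by simp
    then have nl: "nlists (arity f) A = nlists (arity g) A"
      by (simp add: gr_def image_image)
    obtain a where "a \<in> A" using ne by blast
    then have "replicate (arity f) a \<in> nlists (arity f) A" by (rule nlists_replicateI)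
    then have ar: "arity f = arity g" using nl by (metis length_replicate nlistsE_length)
    have "table f = table g"
    proof (rule extensionalityI)
      show "table f \<in> extensional (nlists (arity f) A)"
        using f by (auto simp: operations_def PiE_def)
      show "table g \<in> extensional (nlists (arity f) A)"
        using g ar by (auto simp: operations_def PiE_def)
      fix xs assume "xs \<in> nlists (arity f) A"
      then have "(xs, table f xs) \<in> gr g" using eq by (auto simp: gr_def)
      then show "table f xs = table g xs" by (auto simp: gr_def)
    qed
    with ar show "f = g" by (simp add: prod_eq_iff)
  qed
  moreover have "gr ` operations A \<subseteq> Pow (lists A \<times> A)"
    unfolding gr_def nlists_def lists_eq_set
    using operation_value[unfolded nlists_def] by fastforce
  ultimately have "|operations A| \<le>o |Pow (lists A \<times> A)|"
    by (meson card_of_ordLeqI image_subset_iff)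
  also have "|Pow (lists A \<times> A)| \<le>o |Pow A|"
  proof -
    have "|lists A \<times> A| \<le>o |A|"
      by (intro card_of_Times_ordLeq_infinite[OF A] card_of_lists_ordLeq_infinite[OF A])
        (simp_all add: card_of_mono1)
    then obtain \<phi> where \<phi>: "inj_on \<phi> (lists A \<times> A)" "\<phi> ` (lists A \<times> A) \<subseteq> A"
      by (auto simp: card_of_ordLeq[symmetric])
    then have "inj_on ((`) \<phi>) (Pow (lists A \<times> A))" by (simp add: inj_on_image_Pow)
    moreover have "(`) \<phi> ` Pow (lists A \<times> A) \<subseteq> Pow A" using \<phi>(2) by blast
    ultimately show ?thesis using card_of_ordLeq by blast
  qed
  finally have upper: "|operations A| \<le>o |Pow A|" .
  obtain a where a: "a \<in> A" using ne by blast
  obtain b where b: "b \<in> A" "b \<noteq> a"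
    using A by (metis finite.simps insertI1 subsetI finite_subset)
  define ch where
    "ch X = (1 :: nat, \<lambda>xs\<in>nlists 1 A. if xs ! 0 \<in> X then a else b)" for X
  have "inj_on ch (Pow A)"
  proof (rule inj_onI)
    fix X Y assume X: "X \<in> Pow A" and Y: "Y \<in> Pow A" and eq: "ch X = ch Y"
    have "x \<in> X \<longleftrightarrow> x \<in> Y" if "x \<in> A" for x
    proof -
      have "table (ch X) [x] = table (ch Y) [x]" using eq by simp
      moreover have "[x] \<in> nlists 1 A" using that by (intro nlistsI) simp_all
      ultimately show ?thesis using b by (auto simp: ch_def split: if_splits)
    qed
    then show "X = Y" using X Y by blast
  qed
  moreover have "ch ` Pow A \<subseteq> operations A"
    using a b by (auto simp: ch_def operations_def)
  ultimately have "|Pow A| \<le>o |operations A|" using card_of_ordLeq by blast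
  with upper show ?thesis by (simp add: ordIso_iff_ordLeq)
qed

theorem theorem6p4:
  fixes A :: "'a set" and F :: "'a operation set"
  assumes "infinite A"
    and "F \<subseteq> operations A"
  shows "(clone A (Upsilon_omega A (generated_clone A F)) \<and>
          uncountable (Upsilon_omega A (generated_clone A F)) \<and>
          (\<exists>h \<in> Upsilon_omega A (generated_clone A F). near_unanimity A h)
            \<longrightarrow> |F| =o |Upsilon_omega A (generated_clone A F)| ) \<and>
         (Upsilon_omega A (generated_clone A F) = operations A
            \<longrightarrow> |F| =o ctwo ^c |A| )"
proof (intro conjI impI)
  have ne: "A \<noteq> {}" using assms(1) by auto
  let ?Y = "Upsilon_omega A (generated_clone A F)"
  {
    assume "clone A ?Y \<and> uncountable ?Y \<and> (\<exists>h\<in>?Y. near_unanimity A h)"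
    then show "|F| =o |?Y|" using card_of_Upsilon_omega[OF assms(2) ne] by blast
  next
    assume Y: "?Y = operations A"
    \<comment> \<open>In this case the premises of the cardinality result hold:
      \<open>operations A\<close> has the size of \<open>Pow A\<close>, which is uncountable by
      Cantor's theorem, and it contains a majority operation.\<close>
    have "uncountable (Pow A)"
    proof
      assume "countable (Pow A)"
      then have "Pow A \<lesssim> (UNIV :: nat set)" by (auto simp: lepoll_def countable_def)
      also have "(UNIV :: nat set) \<lesssim> A" using assms(1) by (simp add: infinite_le_lepoll)
      also have "A \<prec> Pow A" by (rule lesspoll_Pow_self)
      finally show False by simp
    qed
    then have "uncountable ?Y"
      using countable_eqpoll[of "operations A" "Pow A"] card_of_operations[OF assms(1)]
      by (metis Y eqpoll_iff_card_of_ordIso eqpoll_sym)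
    then have "|F| =o |?Y|"
      using card_of_Upsilon_omega[OF assms(2) ne] majority_exists[of A] Y by metis
    also have "|?Y| =o |Pow A|" unfolding Y by (rule card_of_operations[OF assms(1)])
    also have "|Pow A| =o ctwo ^c |A|"
      unfolding ctwo_def cexp_def Field_card_of by (rule card_of_Pow_Func)
    finally show "|F| =o ctwo ^c |A|" .
  }
qed

end
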